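(* Let $X_m$ ($m \in \omega$) be non-empty dense-in-itself Polish spaces, let $X$ be a metric space, and let $f_n \colon \prod_{m \in \omega} X_m \to X$ ($n \in \omega$) be $(s^\omega)$-measurable functions. Then there exists a perfect cube $P = \prod_{m \in \omega} P_m$ such that each $f_n|_P$ is continuous.
   Context: A perfect subset of $X_m$ is a non-empty closed subset without isolated points. A perfect cube is a set $P = \prod_{m \in \omega} P_m$ where every $P_m \subseteq X_m$ is perfect. A set $A \subseteq \prod_{m \in \omega} X_m$ has the $(s^\omega)$-property (written $A \in s^\omega$) if for every perfect cube $P$ there is a perfect cube $Q \subseteq P$ such that $Q \subseteq A$ or $Q \subseteq \prod_{m \in \omega} X_m \setminus A$. A function $f \colon \prod_{m \in \omega} X_m \to X$ into a metric space is $(s^\omega)$-measurable if $f^{-1}(U) \in s^\omega$ for every open $U \subseteq X$. Continuity refers to the subspace topology inherited from the product topology. *)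

theory Defs
  imports "HOL-Analysis.Analysis"
begin

definition Polish_space :: "'a topology \<Rightarrow> bool" where
  "Polish_space X \<longleftrightarrow> completely_metrizable_space X \<and> separable_space X"

text \<open>An isolated point of \<open>S\<close> is a point of \<open>S\<close> that is not an accumulation point of \<open>S\<close>.\<close>

definition no_isolated_points_in :: "'a topology \<Rightarrow> 'a set \<Rightarrow> bool" where
  "no_isolated_points_in X S \<longleftrightarrow> S \<subseteq> X derived_set_of S"

definition perfect_in :: "'a topology \<Rightarrow> 'a set \<Rightarrow> bool" where
  "perfect_in X S \<longleftrightarrow> S \<noteq> {} \<and> closedin X S \<and> no_isolated_points_in X S"

definition perfect_cube :: "(nat \<Rightarrow> 'a topology) \<Rightarrow> (nat \<Rightarrow> 'a) set \<Rightarrow> bool" where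
  "perfect_cube X C \<longleftrightarrow> (\<exists>P. (\<forall>m. perfect_in (X m) (P m)) \<and> C = (\<Pi>\<^sub>E m\<in>UNIV. P m))"

definition s_omega :: "(nat \<Rightarrow> 'a topology) \<Rightarrow> (nat \<Rightarrow> 'a) set set" where
  "s_omega X = {A. A \<subseteq> topspace (product_topology X UNIV) \<and>
     (\<forall>P. perfect_cube X P \<longrightarrow>
        (\<exists>Q. perfect_cube X Q \<and> Q \<subseteq> P \<and>
             (Q \<subseteq> A \<or> Q \<subseteq> topspace (product_topology X UNIV) - A)))}"

definition s_omega_measurable ::
    "(nat \<Rightarrow> 'a topology) \<Rightarrow> 'b metric \<Rightarrow> ((nat \<Rightarrow> 'a) \<Rightarrow> 'b) \<Rightarrow> bool" where
  "s_omega_measurable X M f \<longleftrightarrow>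
     f \<in> topspace (product_topology X UNIV) \<rightarrow> mspace M \<and>
     (\<forall>U. openin (mtopology_of M) U \<longrightarrow>
        {x \<in> topspace (product_topology X UNIV). f x \<in> U} \<in> s_omega X)"

end

theory Submission
  imports Defs
begin

text \<open>
  The whole argument is carried out in the Cantor space. Every \<open>X m\<close> contains a homeomorphic copy of
  \<open>nat \<Rightarrow> bool\<close> (lemma \<open>Cantor_injection_into_Polish_space\<close>), so the product contains a copy of the space
  of points \<open>nat \<Rightarrow> nat \<Rightarrow> bool\<close>, and the functions may be pulled back to it. There a cube is described
  by a parametrization: a map acting on each coordinate separately, by an injection whose first \<open>n\<close>
  output bits depend only on the first \<open>n\<close> input bits. These maps are called cubings. They are closed
  under composition, subcubes correspond to compositions, and every perfect set in the Cantor space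
  contains the range of such an injection (\<open>Lipschitz_injection_into_perfect_set\<close>). Consequently the
  \<open>(s\<^sup>\<omega>)\<close>-property turns into \<open>cube_measurable\<close>.

  The tool for building cubes is \<open>fusion\<close>: if countably many hereditary properties can each be reached by
  shrinking any cube, then a single cube splits, for every \<open>n\<close>, into finitely many boxes having the
  \<open>n\<close>-th property. It yields at once that one of countably many measurable sets covering the space
  contains a cube (\<open>countable_cover_contains_cube\<close>). It also yields the theorem as soon as any cube can
  be shrunk so that the image of a given function lies in a ball of prescribed radius \<open>\<epsilon>\<close>: fusing these
  properties for all functions and all radii \<open>1 / (j + 1)\<close> makes every function continuous.

  For a separable target, shrinking the image is immediate from a countable cover by balls. A general
  metric space needs two more ideas, combined in \<open>small_image_on_cube\<close>. Well-order the points and send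
  \<open>z\<close> to the first centre whose \<open>\<epsilon>\<close>-ball contains it. Among the \<open>z\<close> whose ball of radius
  \<open>1 / (k + 1)\<close> lies in the \<open>\<epsilon>\<close>-ball of their centre, nearby points share the same centre; hence
  these \<open>z\<close> with centre in an arbitrary set \<open>S\<close> form a closed set. By the covering property a
  cube maps into one such layer, and on it the centre is a function all of whose preimages are measurable.
  Such a function is constant on a cube (\<open>constant_on_cube\<close>): otherwise fusion makes it continuous, as a
  map into the Cantor space, and on every subcube its range is a perfect set, hence of
  the size of the continuum. As there are only continuum many cubings, a Bernstein
  construction produces a set whose preimage splits every subcube.
\<close>

section \<open>Parametrized cubes in a power of the Cantor space\<close>

definition agree :: "nat \<Rightarrow> (nat \<Rightarrow> bool) \<Rightarrow> (nat \<Rightarrow> bool) \<Rightarrow> bool" where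
  "agree n x y \<longleftrightarrow> (\<forall>i<n. x i = y i)"

text \<open>
  Both the number of coordinates and the number of bits inspected are bounded by \<open>n\<close>, so that each
  level has only finitely many boxes \<open>{y. near n x y}\<close>, while these boxes form a neighbourhood base.
\<close>

definition near :: "nat \<Rightarrow> (nat \<Rightarrow> nat \<Rightarrow> bool) \<Rightarrow> (nat \<Rightarrow> nat \<Rightarrow> bool) \<Rightarrow> bool" where
  "near n x y \<longleftrightarrow> (\<forall>m<n. agree n (x m) (y m))"

text \<open>
  Agreement of \<open>x m\<close> and \<open>y m\<close> up to every \<open>n\<close> means equality, so the first clause also says that the
  \<open>m\<close>-th coordinate of \<open>T x\<close> is a function of \<open>x m\<close> alone. Demanding that a bit never depends on later
  bits (rather than mere continuity) is what lets infinite compositions converge.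
\<close>

definition cubing :: "((nat \<Rightarrow> nat \<Rightarrow> bool) \<Rightarrow> (nat \<Rightarrow> nat \<Rightarrow> bool)) set" where
  "cubing = {T. \<forall>m x y. (\<forall>n. agree n (x m) (y m) \<longrightarrow> agree n (T x m) (T y m)) \<and>
                         (T x m = T y m \<longrightarrow> x m = y m)}"

lemma agree_refl [simp]: "agree n x x"
  by (simp add: agree_def)

lemma agree_sym: "agree n x y \<Longrightarrow> agree n y x"
  by (simp add: agree_def)

lemma agree_trans: "agree n x y \<Longrightarrow> agree n y z \<Longrightarrow> agree n x z"
  by (simp add: agree_def)

lemma agree_mono: "agree n x y \<Longrightarrow> k \<le> n \<Longrightarrow> agree k x y"
  by (simp add: agree_def)

lemma agree_all_imp_eq: "(\<And>n. agree n x y) \<Longrightarrow> x = y"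
  by (rule ext) (meson agree_def lessI)

lemma near_refl [simp]: "near n x x"
  by (simp add: near_def)

lemma near_sym: "near n x y \<Longrightarrow> near n y x"
  by (simp add: near_def agree_def)

lemma near_trans: "near n x y \<Longrightarrow> near n y z \<Longrightarrow> near n x z"
  by (simp add: near_def agree_def)

lemma near_mono: "near n x y \<Longrightarrow> k \<le> n \<Longrightarrow> near k x y"
  by (simp add: near_def agree_def)

lemma near_all_imp_eq:
  assumes "\<And>n. n \<ge> N \<Longrightarrow> near n x y"
  shows "x = y"
proof (intro ext)
  fix m i
  have "near (Suc (N + m + i)) x y"
    using assms by simp
  then show "x m i = y m i"
    by (simp add: near_def agree_def)
qed

lemma cubingI:
  assumes "\<And>m n x y. agree n (x m) (y m) \<Longrightarrow> agree n (T x m) (T y m)"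
    and "\<And>m x y. T x m = T y m \<Longrightarrow> x m = y m"
  shows "T \<in> cubing"
  using assms unfolding cubing_def by blast

lemma cubing_agree: "T \<in> cubing \<Longrightarrow> agree n (x m) (y m) \<Longrightarrow> agree n (T x m) (T y m)"
  unfolding cubing_def by blast

lemma cubing_inj: "T \<in> cubing \<Longrightarrow> T x m = T y m \<Longrightarrow> x m = y m"
  unfolding cubing_def by blast

lemma cubing_near: "T \<in> cubing \<Longrightarrow> near n x y \<Longrightarrow> near n (T x) (T y)"
  unfolding near_def by (blast intro: cubing_agree)

lemma cubing_coordinate:
  assumes "T \<in> cubing" "x m = y m"
  shows "T x m = T y m"
  using assms by (metis agree_all_imp_eq agree_refl cubing_agree)

lemma id_cubing: "id \<in> cubing"
  by (rule cubingI) auto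

lemma comp_cubing: "S \<in> cubing \<Longrightarrow> T \<in> cubing \<Longrightarrow> S \<circ> T \<in> cubing"
  by (rule cubingI) (auto intro: cubing_agree dest: cubing_inj)

text \<open>
  The canonical parametrization of the box \<open>{y. near n x y}\<close>, and (as \<open>ungraft\<close>) its inverse there.
\<close>

definition graft :: "nat \<Rightarrow> (nat \<Rightarrow> nat \<Rightarrow> bool) \<Rightarrow> (nat \<Rightarrow> nat \<Rightarrow> bool) \<Rightarrow> (nat \<Rightarrow> nat \<Rightarrow> bool)" where
  "graft n x y = (\<lambda>m i. if m < n then (if i < n then x m i else y m (i - n)) else y m i)"

definition ungraft :: "nat \<Rightarrow> (nat \<Rightarrow> nat \<Rightarrow> bool) \<Rightarrow> (nat \<Rightarrow> nat \<Rightarrow> bool)" where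
  "ungraft n y = (\<lambda>m i. if m < n then y m (i + n) else y m i)"

lemma graft_near: "near n x (graft n x y)"
  by (simp add: near_def agree_def graft_def)

lemma graft_cubing: "graft n x \<in> cubing"
proof (rule cubingI)
  fix m k and y z :: "nat \<Rightarrow> nat \<Rightarrow> bool" assume "agree k (y m) (z m)"
  then show "agree k (graft n x y m) (graft n x z m)"
    by (auto simp: agree_def graft_def)
next
  fix m and y z :: "nat \<Rightarrow> nat \<Rightarrow> bool" assume eq: "graft n x y m = graft n x z m"
  show "y m = z m"
  proof
    fix i
    show "y m i = z m i"
      using fun_cong[OF eq, of i] fun_cong[OF eq, of "i + n"]
      by (auto simp: graft_def split: if_splits)
  qed
qed

section \<open>Fusion\<close>

definition hereditary :: "('a set \<Rightarrow> bool) \<Rightarrow> bool" where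
  "hereditary P \<longleftrightarrow> (\<forall>A B. P B \<longrightarrow> A \<subseteq> B \<longrightarrow> P A)"

definition cofinal :: "((nat \<Rightarrow> nat \<Rightarrow> bool) set \<Rightarrow> bool) \<Rightarrow> bool" where
  "cofinal P \<longleftrightarrow> (\<forall>T\<in>cubing. \<exists>S\<in>cubing. P (range (T \<circ> S)))"

text \<open>
  The given box is reparametrized by \<open>graft n x\<close>, shrunk, and put back. Coordinates below \<open>n\<close>
  keep their first \<open>n\<close> bits, and there only sequences agreeing with the box are moved, so
  the modified map remains injective. Coordinates from \<open>n\<close> on cannot distinguish boxes and
  are shrunk everywhere.
\<close>

lemma shrink_one_box:
  assumes her: "hereditary P" and cof: "cofinal P" and T: "T \<in> cubing"
  shows "\<exists>S\<in>cubing. (\<forall>y. near n y (S y)) \<and> P ((T \<circ> S) ` {y. near n x y})"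
proof -
  have "T \<circ> graft n x \<in> cubing"
    by (simp add: T graft_cubing comp_cubing)
  then obtain R where R: "R \<in> cubing" and PR: "P (range (T \<circ> graft n x \<circ> R))"
    using cof unfolding cofinal_def by blast
  define S where "S y m = (if m < n \<and> \<not> agree n (x m) (y m) then y m
      else graft n x (R (ungraft n y)) m)" for y m
  have S_near: "near n y (S y)" for y
    unfolding near_def S_def by (auto simp: graft_def agree_def)
  have "S \<in> cubing"
  proof (rule cubingI)
    fix m k and y z :: "nat \<Rightarrow> nat \<Rightarrow> bool" assume yz: "agree k (y m) (z m)"
    show "agree k (S y m) (S z m)"
    proof (cases "m < n \<and> k \<le> n")
      case True
      then have "agree k (S y m) (y m)" "agree k (z m) (S z m)"
        using S_near[of y] S_near[of z] unfolding near_def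
        by (meson agree_mono agree_sym)+
      then show ?thesis
        using yz by (meson agree_trans)
    next
      case False
      show ?thesis
      proof (cases "m < n")
        case True
        with False have "k > n" by simp
        then have ag: "agree n (x m) (y m) = agree n (x m) (z m)"
          using yz unfolding agree_def by auto
        have "agree (k - n) (ungraft n y m) (ungraft n z m)"
          using yz True by (auto simp: agree_def ungraft_def)
        then have "agree (k - n) (R (ungraft n y) m) (R (ungraft n z) m)"
          by (rule cubing_agree[OF R])
        then have "agree k (graft n x (R (ungraft n y)) m) (graft n x (R (ungraft n z)) m)"
          using True \<open>k > n\<close> by (auto simp: agree_def graft_def)
        then show ?thesis
          using ag yz by (simp add: S_def)
      next
        case False
        have "agree k (ungraft n y m) (ungraft n z m)"
          using yz False by (auto simp: agree_def ungraft_def)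
        then have "agree k (R (ungraft n y) m) (R (ungraft n z) m)"
          by (rule cubing_agree[OF R])
        then show ?thesis
          using False by (simp add: S_def graft_def agree_def)
      qed
    qed
  next
    fix m and y z :: "nat \<Rightarrow> nat \<Rightarrow> bool" assume eq: "S y m = S z m"
    have near: "near n y (S y)" "near n z (S z)"
      by (rule S_near)+
    show "y m = z m"
    proof (cases "m < n")
      case True
      have "agree n (y m) (z m)"
        using near True eq unfolding near_def by (metis agree_sym agree_trans)
      then have ag: "agree n (x m) (y m) = agree n (x m) (z m)"
        by (meson agree_sym agree_trans)
      show ?thesis
      proof (cases "agree n (x m) (y m)")
        case False
        then show ?thesis
          using eq ag True by (simp add: S_def)
      next
        case agr: True
        then have "graft n x (R (ungraft n y)) m = graft n x (R (ungraft n z)) m"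
          using eq ag by (simp add: S_def)
        then have "ungraft n y m = ungraft n z m"
          using cubing_inj[OF graft_cubing] cubing_inj[OF R] by blast
        then have "y m (i + n) = z m (i + n)" for i
          using True by (simp add: ungraft_def fun_eq_iff)
        moreover have "y m i = z m i" if "i < n" for i
          using that \<open>agree n (y m) (z m)\<close> by (simp add: agree_def)
        ultimately have "y m i = z m i" for i
          by (cases "i < n") (metis le_add_diff_inverse2 not_le)+
        then show ?thesis by (rule ext)
      qed
    next
      case False
      then have "graft n x (R (ungraft n y)) m = graft n x (R (ungraft n z)) m"
        using eq by (simp add: S_def)
      then have "ungraft n y m = ungraft n z m"
        using cubing_inj[OF graft_cubing] cubing_inj[OF R] by blast
      then show ?thesis
        using False by (simp add: ungraft_def)
    qed
  qed
  moreover have "(T \<circ> S) ` {y. near n x y} \<subseteq> range (T \<circ> graft n x \<circ> R)"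
  proof clarify
    fix y assume "near n x y"
    then have "S y = graft n x (R (ungraft n y))"
      unfolding S_def near_def by (intro ext) auto
    then show "(T \<circ> S) y \<in> range (T \<circ> graft n x \<circ> R)"
      by simp
  qed
  then have "P ((T \<circ> S) ` {y. near n x y})"
    using PR her unfolding hereditary_def by blast
  ultimately show ?thesis
    using S_near by blast
qed

lemma finite_box_representatives:
  "\<exists>F. finite F \<and> (\<forall>x. \<exists>r\<in>F. near n r x)"
proof -
  let ?F = "(\<lambda>A m i. (m, i) \<in> A) ` Pow ({..<n} \<times> {..<n})"
  have "\<exists>r\<in>?F. near n r x" for x
  proof
    show "near n (\<lambda>m i. (m, i) \<in> {(m, i). m < n \<and> i < n \<and> x m i}) x"
      by (simp add: near_def agree_def)
    show "(\<lambda>m i. (m, i) \<in> {(m, i). m < n \<and> i < n \<and> x m i}) \<in> ?F"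
      by (rule imageI) auto
  qed
  moreover have "finite ?F" by simp
  ultimately show ?thesis by blast
qed

text \<open>
  The finitely many boxes of level \<open>n\<close> are treated one after another. Each step maps every box into
  itself, so what was achieved on earlier boxes is inherited.
\<close>

lemma shrink_all_boxes:
  assumes her: "hereditary P" and cof: "cofinal P" and T: "T \<in> cubing"
  shows "\<exists>S\<in>cubing. (\<forall>y. near n y (S y)) \<and> (\<forall>x. P ((T \<circ> S) ` {y. near n x y}))"
proof -
  obtain F where F: "finite F" "\<And>x. \<exists>r\<in>F. near n r x"
    using finite_box_representatives by blast
  have "\<exists>S\<in>cubing. (\<forall>y. near n y (S y)) \<and> (\<forall>r\<in>F. P ((T \<circ> S) ` {y. near n r y}))"
    using \<open>finite F\<close>
  proof (induction F)
    case empty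
    show ?case using id_cubing by force
  next
    case (insert r F)
    then obtain S where S: "S \<in> cubing" "\<And>y. near n y (S y)"
        "\<And>r. r \<in> F \<Longrightarrow> P ((T \<circ> S) ` {y. near n r y})"
      by blast
    obtain S' where S': "S' \<in> cubing" "\<And>y. near n y (S' y)"
        "P ((T \<circ> S \<circ> S') ` {y. near n r y})"
      using shrink_one_box[OF her cof comp_cubing[OF T S(1)]] by blast
    have "P ((T \<circ> (S \<circ> S')) ` {y. near n q y})" if "q \<in> insert r F" for q
    proof (cases "q = r")
      case True
      then show ?thesis using S'(3) by (simp add: comp_assoc)
    next
      case False
      have "(T \<circ> (S \<circ> S')) ` {y. near n q y} \<subseteq> (T \<circ> S) ` {y. near n q y}"
        using S'(2) near_trans by fastforce
      then show ?thesis
        using False that S(3) her unfolding hereditary_def by blast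
    qed
    moreover have "near n y ((S \<circ> S') y)" for y
      using S(2) S'(2) near_trans by fastforce
    ultimately show ?case
      using comp_cubing[OF S(1) S'(1)] by blast
  qed
  then obtain S where S: "S \<in> cubing" "\<And>y. near n y (S y)"
      "\<And>r. r \<in> F \<Longrightarrow> P ((T \<circ> S) ` {y. near n r y})"
    by blast
  have "P ((T \<circ> S) ` {y. near n x y})" for x
  proof -
    obtain r where "r \<in> F" "near n r x" using F by blast
    then have "{y. near n x y} = {y. near n r y}"
      using near_trans near_sym by blast
    then show ?thesis using S(3) \<open>r \<in> F\<close> by simp
  qed
  with S show ?thesis by blast
qed

text \<open>
  The maps \<open>L n\<close> are the infinite compositions \<open>S n \<circ> S (n + 1) \<circ> \<dots>\<close>. They exist because \<open>S k\<close> fixes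
  the boxes of level \<open>k\<close> and the earlier factors preserve agreement, so each bit is eventually constant.
  Injectivity survives: \<open>L 0\<close> is \<open>L n\<close> followed by a finite composition, and \<open>L n\<close> does not
  change the first \<open>n\<close> bits of the first \<open>n\<close> coordinates.
\<close>

lemma infinite_composition:
  assumes S: "\<And>n. S n \<in> cubing" and S_near: "\<And>n y. near n y (S n y)"
  obtains L where "\<And>n. L n = S n \<circ> L (Suc n)" "\<And>n x. near n x (L n x)" "L 0 \<in> cubing"
proof -
  define U where "U n j = rec_nat id (\<lambda>i V. V \<circ> S (n + i)) j" for n j
  have U0: "U n 0 = id" and USuc: "U n (Suc j) = U n j \<circ> S (n + j)" for n j
    by (simp_all add: U_def)
  have U_cubing: "U n j \<in> cubing" for n j
  proof (induction j)
    case 0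
    show ?case unfolding U0 by (rule id_cubing)
  next
    case (Suc j)
    then show ?case unfolding USuc by (intro comp_cubing S)
  qed
  have U_shift: "U n (Suc j) = S n \<circ> U (Suc n) j" for n j
  proof (induction j)
    case 0
    show ?case by (simp add: U0 USuc)
  next
    case (Suc j)
    have "U n (Suc (Suc j)) = S n \<circ> U (Suc n) j \<circ> S (n + Suc j)"
      unfolding USuc[of n "Suc j"] Suc.IH ..
    then show ?case
      by (simp add: USuc fun_eq_iff)
  qed
  have U_step: "near (n + j) (U n j x) (U n (Suc j) x)" for n j x
    using S_near cubing_near[OF U_cubing] by (simp add: USuc)
  have U_later: "near (n + j) (U n j x) (U n (j + l) x)" for n j l x
  proof (induction l)
    case (Suc l)
    have "near (n + (j + l)) (U n (j + l) x) (U n (Suc (j + l)) x)"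
      by (rule U_step)
    then have "near (n + j) (U n (j + l) x) (U n (Suc (j + l)) x)"
      by (rule near_mono) simp
    with Suc show ?case by (auto intro: near_trans)
  qed simp
  \<comment> \<open>Bit \<open>(m, i)\<close> no longer changes once more than \<open>max m i\<close> maps have been composed.\<close>
  define L where "L n x m i = U n (Suc (max m i)) x m i" for n x m i
  have L_near: "near j (U n j x) (L n x)" for n j x
  proof -
    have "U n j x m i = L n x m i" if "m < j" "i < j" for m i
    proof -
      let ?k = "Suc (max m i)"
      have "near (n + ?k) (U n ?k x) (U n (?k + (j - ?k)) x)"
        by (rule U_later)
      moreover have "?k + (j - ?k) = j" using that by simp
      ultimately have "near (n + ?k) (U n ?k x) (U n j x)" by metis
      then show ?thesis
        by (simp add: L_def near_def agree_def)
    qed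
    then show ?thesis by (simp add: near_def agree_def)
  qed
  have L_near': "near n x (L n x)" for n x
  proof -
    have "near n x (U n n x)"
      using U_later[of n 0 x n] by (simp add: U0)
    with L_near show ?thesis by (rule near_trans[rotated])
  qed
  have L_unfold: "L n = S n \<circ> L (Suc n)" for n
  proof
    fix x
    have "near j (L n x) (S n (L (Suc n) x))" for j
    proof -
      have "near j (U n (Suc j) x) (L n x)"
        by (rule near_mono[OF L_near]) simp
      moreover have "near j (S n (U (Suc n) j x)) (S n (L (Suc n) x))"
        by (rule cubing_near[OF S L_near])
      ultimately show ?thesis
        using U_shift near_sym near_trans by (metis comp_apply)
    qed
    then show "L n x = (S n \<circ> L (Suc n)) x"
      by (metis near_all_imp_eq comp_apply)
  qed
  have L_U: "L 0 = U 0 n \<circ> L n" for n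
  proof (induction n)
    case (Suc n)
    then have "L 0 = U 0 n \<circ> (S n \<circ> L (Suc n))"
      by (simp only: L_unfold[of n])
    then show ?case
      by (simp add: USuc fun_eq_iff)
  qed (simp add: U0)
  have "L 0 \<in> cubing"
  proof (rule cubingI)
    fix m k and x y :: "nat \<Rightarrow> nat \<Rightarrow> bool" assume "agree k (x m) (y m)"
    then have "agree k (U 0 j x m) (U 0 j y m)" for j
      by (rule cubing_agree[OF U_cubing])
    then show "agree k (L 0 x m) (L 0 y m)"
      by (simp add: agree_def L_def)
  next
    fix m and x y :: "nat \<Rightarrow> nat \<Rightarrow> bool" assume eq: "L 0 x m = L 0 y m"
    show "x m = y m"
    proof
      fix i
      let ?n = "Suc (max m i)"
      have "U 0 ?n (L ?n x) m = U 0 ?n (L ?n y) m"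
        using eq fun_cong[OF L_U[of ?n], of x] fun_cong[OF L_U[of ?n], of y] by simp
      then have "L ?n x m = L ?n y m"
        by (rule cubing_inj[OF U_cubing])
      moreover have "near ?n x (L ?n x)" "near ?n y (L ?n y)"
        by (rule L_near')+
      ultimately show "x m i = y m i"
        by (simp add: near_def agree_def less_Suc_eq_le)
    qed
  qed
  with L_unfold L_near' show ?thesis by (rule that)
qed

text \<open>
  Apply \<open>shrink_all_boxes\<close> at stage \<open>n\<close> to the composition reached so far. The limit on a box of level \<open>n\<close>
  factors through stage \<open>n\<close> restricted to that box.
\<close>

theorem fusion:
  assumes her: "\<And>n. hereditary (P n)" and cof: "\<And>n. cofinal (P n)"
  obtains T where "T \<in> cubing" "\<And>n x. P n (T ` {y. near n x y})"
proof -
  define step where "step n T = (SOME S. S \<in> cubing \<and> (\<forall>y. near n y (S y)) \<and>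
      (\<forall>x. P n ((T \<circ> S) ` {y. near n x y})))" for n :: nat and T
  have step: "step n T \<in> cubing" "near n y (step n T y)"
      "P n ((T \<circ> step n T) ` {y. near n x y})" if "T \<in> cubing" for n T x y
  proof -
    have "\<exists>S. S \<in> cubing \<and> (\<forall>y. near n y (S y)) \<and> (\<forall>x. P n ((T \<circ> S) ` {y. near n x y}))"
      using shrink_all_boxes[OF her cof that] by blast
    from someI_ex[OF this] show "step n T \<in> cubing" "near n y (step n T y)"
      "P n ((T \<circ> step n T) ` {y. near n x y})"
      unfolding step_def by blast+
  qed
  define T where "T n = rec_nat id (\<lambda>n T. T \<circ> step n T) n" for n
  have T0: "T 0 = id" and TSuc: "T (Suc n) = T n \<circ> step n (T n)" for n
    by (simp_all add: T_def)
  have T_cubing: "T n \<in> cubing" for n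
  proof (induction n)
    case 0
    show ?case unfolding T0 by (rule id_cubing)
  next
    case (Suc n)
    then show ?case unfolding TSuc by (intro comp_cubing step(1))
  qed
  obtain L where L: "\<And>n. L n = step n (T n) \<circ> L (Suc n)" "\<And>n x. near n x (L n x)"
      "L 0 \<in> cubing"
    using infinite_composition[of "\<lambda>n. step n (T n)"] step T_cubing by metis
  have L_T: "L 0 = T n \<circ> L n" for n
  proof (induction n)
    case (Suc n)
    then have "L 0 = T n \<circ> (step n (T n) \<circ> L (Suc n))"
      by (simp only: L(1)[of n])
    then show ?case
      by (simp add: TSuc fun_eq_iff)
  qed (simp add: T0)
  have "P n (L 0 ` {y. near n x y})" for n x
  proof -
    have "L 0 ` {y. near n x y} \<subseteq> (T n \<circ> step n (T n)) ` {y. near n x y}"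
    proof clarify
      fix y assume "near n x y"
      then have "near n x (L (Suc n) y)"
        using L(2)[of "Suc n" y] by (meson near_mono near_trans le_SucI le_refl)
      moreover have "L 0 y = (T n \<circ> step n (T n)) (L (Suc n) y)"
        using fun_cong[OF L_T[of n], of y] fun_cong[OF L(1)[of n], of y] by simp
      ultimately show "L 0 y \<in> (T n \<circ> step n (T n)) ` {y. near n x y}"
        by blast
    qed
    then show ?thesis
      using step(3)[OF T_cubing] her unfolding hereditary_def by blast
  qed
  with L(3) show ?thesis by (rule that)
qed

section \<open>Topology of the Cantor space\<close>

lemma compact_space_bool_sequences: "compact_space (euclidean :: (nat \<Rightarrow> bool) topology)"
proof -
  have "compact_space (product_topology (\<lambda>i::nat. euclidean :: bool topology) UNIV)"
    unfolding compact_space_product_topology by (simp add: compact_space_def finite_imp_compact)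
  then show ?thesis
    by (simp only: euclidean_product_topology)
qed

lemma Hausdorff_space_bool_sequences: "Hausdorff_space (euclidean :: (nat \<Rightarrow> bool) topology)"
proof -
  have "Hausdorff_space (euclidean :: bool topology)"
    unfolding Hausdorff_space_def disjnt_def by (metis hausdorff open_openin)
  then have "Hausdorff_space (product_topology (\<lambda>i::nat. euclidean :: bool topology) UNIV)"
    unfolding Hausdorff_space_product_topology by blast
  then show ?thesis
    by (simp only: euclidean_product_topology)
qed

lemma compact_space_points: "compact_space (euclidean :: (nat \<Rightarrow> nat \<Rightarrow> bool) topology)"
proof -
  have "compact_space (product_topology (\<lambda>i::nat. euclidean :: (nat \<Rightarrow> bool) topology) UNIV)"
    unfolding compact_space_product_topology by (simp add: compact_space_bool_sequences)
  then show ?thesis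
    by (simp only: euclidean_product_topology)
qed

lemma open_agree: "open {y. agree n x y}"
proof -
  have "open {y. \<forall>i\<in>{..<n}. y i \<in> {x i}}"
    by (rule product_topology_basis') (auto simp: open_discrete)
  also have "{y. \<forall>i\<in>{..<n}. y i \<in> {x i}} = {y. agree n x y}"
    by (auto simp: agree_def)
  finally show ?thesis .
qed

lemma open_near: "open {y. near n x y}"
proof -
  have "open {y. \<forall>m\<in>{..<n}. y m \<in> {z. agree n (x m) z}}"
    by (rule product_topology_basis') (auto simp: open_agree)
  also have "{y. \<forall>m\<in>{..<n}. y m \<in> {z. agree n (x m) z}} = {y. near n x y}"
    by (auto simp: near_def)
  finally show ?thesis .
qed

lemma open_contains_agree:
  assumes "open U" "x \<in> U"
  obtains n where "{y. agree n x y} \<subseteq> U"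
proof -
  have "openin (product_topology (\<lambda>i::nat. euclidean :: bool topology) UNIV) U"
    using assms by (simp add: euclidean_product_topology)
  then obtain V where V: "x \<in> (\<Pi>\<^sub>E i\<in>UNIV. V i)" "finite {i. V i \<noteq> UNIV}"
      "(\<Pi>\<^sub>E i\<in>UNIV. V i) \<subseteq> U"
    using product_topology_open_contains_basis[of _ UNIV U x] assms by force
  obtain n where n: "\<And>i. V i \<noteq> UNIV \<Longrightarrow> i < n"
    using finite_nat_bounded[OF V(2)] by blast
  have "{y. agree n x y} \<subseteq> (\<Pi>\<^sub>E i\<in>UNIV. V i)"
  proof
    fix y assume y: "y \<in> {y. agree n x y}"
    have "y i \<in> V i" for i
    proof (cases "i < n")
      case True
      then have "y i = x i" using y by (simp add: agree_def)
      then show ?thesis using V(1) by (simp add: PiE_UNIV_domain Pi_iff)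
    next
      case False
      then show ?thesis using n by blast
    qed
    then show "y \<in> (\<Pi>\<^sub>E i\<in>UNIV. V i)" by (simp add: PiE_UNIV_domain)
  qed
  with V(3) show ?thesis by (intro that) blast
qed

lemma continuous_map_agreeI:
  assumes "\<And>x. f x \<in> topspace Y"
    and "\<And>x U. openin Y U \<Longrightarrow> f x \<in> U \<Longrightarrow> \<exists>n. \<forall>y. agree n x y \<longrightarrow> f y \<in> U"
  shows "continuous_map euclidean Y f"
  unfolding continuous_map_def
proof (intro conjI allI impI)
  fix U assume U: "openin Y U"
  have "open {x. f x \<in> U}"
  proof (rule topological_space_class.openI)
    fix x assume "x \<in> {x. f x \<in> U}"
    then obtain n where "{y. agree n x y} \<subseteq> {x. f x \<in> U}"
      using assms(2)[OF U] by blast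
    then show "\<exists>T. open T \<and> x \<in> T \<and> T \<subseteq> {x. f x \<in> U}"
      by (intro exI[of _ "{y. agree n x y}"]) (simp add: open_agree)
  qed
  then show "openin euclidean {x \<in> topspace euclidean. f x \<in> U}"
    by (simp flip: open_openin)
qed (use assms in auto)

lemma continuous_map_nearI:
  assumes "\<And>x. f x \<in> topspace Y"
    and "\<And>x U. openin Y U \<Longrightarrow> f x \<in> U \<Longrightarrow> \<exists>n. \<forall>y. near n x y \<longrightarrow> f y \<in> U"
  shows "continuous_map euclidean Y f"
  unfolding continuous_map_def
proof (intro conjI allI impI)
  fix U assume U: "openin Y U"
  have "open {x. f x \<in> U}"
  proof (rule topological_space_class.openI)
    fix x assume "x \<in> {x. f x \<in> U}"
    then obtain n where "{y. near n x y} \<subseteq> {x. f x \<in> U}"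
      using assms(2)[OF U] by blast
    then show "\<exists>T. open T \<and> x \<in> T \<and> T \<subseteq> {x. f x \<in> U}"
      by (intro exI[of _ "{y. near n x y}"]) (simp add: open_near)
  qed
  then show "openin euclidean {x \<in> topspace euclidean. f x \<in> U}"
    by (simp flip: open_openin)
qed (use assms in auto)

lemma closed_contains_agree_limit:
  assumes "closed K" "\<And>n. \<exists>y\<in>K. agree n x y"
  shows "x \<in> K"
proof (rule ccontr)
  assume "x \<notin> K"
  then obtain n where "{y. agree n x y} \<subseteq> - K"
    using open_contains_agree[of "- K" x] assms(1) by (auto simp: closed_def)
  with assms(2) show False by blast
qed

text \<open>
  Such a map is uniformly continuous, so its range is compact.
\<close>

lemma closed_range_if_near_agree:
  assumes "\<And>n x y. near n x y \<Longrightarrow> agree n (G x) (G y)"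
  shows "closed (range G)"
proof -
  have "continuous_map euclidean euclidean G"
  proof (rule continuous_map_nearI)
    fix x U assume "openin euclidean U" "G x \<in> U"
    then obtain n where "{y. agree n (G x) y} \<subseteq> U"
      by (metis open_contains_agree open_openin)
    then show "\<exists>n. \<forall>y. near n x y \<longrightarrow> G y \<in> U"
      using assms by blast
  qed simp
  then have "compactin euclidean (range G)"
    using compact_space_points image_compactin[of euclidean UNIV euclidean G]
    by (simp add: compact_space_def del: compactin_euclidean_iff)
  then show ?thesis
    using compactin_imp_closedin[OF Hausdorff_space_bool_sequences] closed_closedin by blast
qed

lemma first_difference:
  assumes "s \<noteq> t"
  obtains k where "agree k s t" "s k \<noteq> t k"
proof -
  have ex: "\<exists>k. s k \<noteq> t k" using assms by auto
  let ?k = "LEAST k. s k \<noteq> t k"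
  have "s ?k \<noteq> t ?k" using ex by (rule LeastI_ex)
  moreover have "agree ?k s t" unfolding agree_def using not_less_Least by blast
  ultimately show ?thesis by (intro that)
qed

text \<open>
  Dependent choice along the full binary tree. The node \<open>N t k\<close> is the one reached after reading the first
  \<open>k\<close> bits of \<open>t\<close>, and \<open>b\<close> is the pair of its children.
\<close>

lemma binary_branches:
  fixes a0 :: 'a
  assumes "P a0" and "\<And>a. P a \<Longrightarrow> \<exists>b :: bool \<Rightarrow> 'a. (\<forall>i. P (b i)) \<and> R a b"
  shows "\<exists>N. (\<forall>t k. P (N t k)) \<and> (\<forall>k s t. agree k s t \<longrightarrow> N s k = N t k) \<and>
    (\<forall>k t. \<exists>b. R (N t k) b \<and> (\<forall>s. agree k s t \<longrightarrow> N s (Suc k) = b (s k)))"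
proof -
  obtain c where c: "\<And>a i. P a \<Longrightarrow> P (c a i)" "\<And>a. P a \<Longrightarrow> R a (c a)"
    using assms(2) by metis
  define N where "N t k = rec_nat a0 (\<lambda>k a. c a (t k)) k" for t and k :: nat
  have N0: "N t 0 = a0" and NSuc: "N t (Suc k) = c (N t k) (t k)" for t k
    by (simp_all add: N_def)
  have P: "P (N t k)" for t k
    by (induction k) (use N0 NSuc assms(1) c in auto)
  have eq: "N s k = N t k" if "agree k s t" for k s t
    using that by (induction k) (auto simp: N0 NSuc agree_def)
  have "R (N t k) (c (N t k)) \<and> (\<forall>s. agree k s t \<longrightarrow> N s (Suc k) = c (N t k) (s k))" for k t
    using c(2)[OF P, of t k] eq by (simp add: NSuc)
  then have R: "\<exists>b. R (N t k) b \<and> (\<forall>s. agree k s t \<longrightarrow> N s (Suc k) = b (s k))" for k t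
    by blast
  show ?thesis
    using P eq R by blast
qed

text \<open>
  A splitting scheme whose nodes are pairs \<open>(n, x)\<close> with \<open>x \<in> K\<close>, standing for the part of \<open>K\<close> that agrees
  with \<open>x\<close> on \<open>n\<close> bits. Since \<open>n\<close> grows by at least one in each step, the node at depth \<open>k\<close> determines
  at least \<open>k\<close> bits of the limit; this gives the dependence of bits on earlier bits only.
\<close>

lemma Lipschitz_injection_into_perfect_set:
  assumes ne: "K \<noteq> {}" and closed: "closed K"
    and crowded: "\<And>x n. x \<in> K \<Longrightarrow> \<exists>y\<in>K. y \<noteq> x \<and> agree n x y"
  shows "\<exists>\<theta>. range \<theta> \<subseteq> K \<and> inj \<theta> \<and> (\<forall>n s t. agree n s t \<longrightarrow> agree n (\<theta> s) (\<theta> t))"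
proof -
  obtain x0 where x0: "x0 \<in> K" using ne by blast
  define P where "P a \<longleftrightarrow> snd a \<in> K" for a :: "nat \<times> (nat \<Rightarrow> bool)"
  define R where "R a b \<longleftrightarrow> (\<exists>n > fst a. (\<forall>i. fst (b i) = n \<and> agree (fst a) (snd a) (snd (b i))) \<and>
      \<not> agree n (snd (b False)) (snd (b True)))"
    for a :: "nat \<times> (nat \<Rightarrow> bool)" and b :: "bool \<Rightarrow> nat \<times> (nat \<Rightarrow> bool)"
  \<comment> \<open>The children are two points of \<open>K\<close> agreeing as far as the parent prescribes, cut just after a difference.\<close>
  have child: "\<exists>b. (\<forall>i. P (b i)) \<and> R a b" if "P a" for a
  proof -
    obtain y where y: "y \<in> K" "y \<noteq> snd a" "agree (fst a) (snd a) y"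
      using crowded \<open>P a\<close> unfolding P_def by blast
    from y(2) obtain k where k: "y k \<noteq> snd a k" by auto
    define n where "n = Suc (max k (fst a))"
    define b where "b i = (n, if i then y else snd a)" for i
    have "\<not> agree n (snd a) y"
      using k unfolding agree_def n_def by (metis less_Suc_eq_le max.cobounded1)
    then have "R a b"
      unfolding R_def b_def using y(3) by (auto simp: n_def)
    moreover have "\<forall>i. P (b i)"
      using y \<open>P a\<close> by (simp add: P_def b_def)
    ultimately show ?thesis by blast
  qed
  have root: "P (0, x0)" using x0 by (simp add: P_def)
  obtain N where N_K: "\<And>t k. P (N t k)"
    and N_cong: "\<And>k s t. agree k s t \<Longrightarrow> N s k = N t k"
    and N_R: "\<And>k t. \<exists>b. R (N t k) b \<and> (\<forall>s. agree k s t \<longrightarrow> N s (Suc k) = b (s k))"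
    using binary_branches[of P "(0, x0)" R, OF root child] by blast
  define n where "n t k = fst (N t k)" for t k
  define p where "p t k = snd (N t k)" for t k
  have next_node: "n t k < n t (Suc k) \<and> agree (n t k) (p t k) (p t (Suc k))" for t k
  proof -
    obtain b where "R (N t k) b" "N t (Suc k) = b (t k)"
      using N_R[of t k] agree_refl by blast
    then show ?thesis unfolding n_def p_def R_def by auto
  qed
  have n_ge: "k \<le> n t k" for t k
  proof (induction k)
    case (Suc k)
    then show ?case using next_node[of t k] by linarith
  qed simp
  have n_mono: "n t k \<le> n t j" if "k \<le> j" for t k j
    using lift_Suc_mono_le[of "n t" k j] next_node that by (simp add: less_imp_le)
  have coherent: "agree (n t k) (p t k) (p t j)" if "k \<le> j" for t k j
    using that
  proof (induction j rule: dec_induct)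
    case (step j)
    have "agree (n t k) (p t j) (p t (Suc j))"
      using next_node n_mono[OF step(1)] agree_mono by blast
    with step.IH show ?case by (rule agree_trans)
  qed simp
  define \<theta> where "\<theta> t i = p t (Suc i) i" for t i
  have \<theta>: "agree (n t k) (p t k) (\<theta> t)" for t k
    unfolding agree_def
  proof (intro allI impI)
    fix i assume "i < n t k"
    show "p t k i = \<theta> t i"
    proof (cases "Suc i \<le> k")
      case True
      have "i < n t (Suc i)" using n_ge[of "Suc i" t] by simp
      then show ?thesis
        using coherent[OF True, of t] by (simp add: agree_def \<theta>_def)
    next
      case False
      then show ?thesis
        using coherent[of k "Suc i" t] \<open>i < n t k\<close> by (simp add: agree_def \<theta>_def)
    qed
  qed
  have "range \<theta> \<subseteq> K"
  proof clarify
    fix t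
    have "agree k (\<theta> t) (p t k)" for k
      using \<theta> n_ge agree_mono agree_sym by blast
    moreover have "p t k \<in> K" for k
      using N_K by (simp add: P_def p_def)
    ultimately show "\<theta> t \<in> K"
      using closed_contains_agree_limit[OF closed] by blast
  qed
  moreover have "agree k (\<theta> s) (\<theta> t)" if "agree k s t" for k s t
  proof -
    have "agree k (p t k) (\<theta> s)" "agree k (p t k) (\<theta> t)"
      using \<theta>[of s k] \<theta>[of t k] n_ge[of k s] n_ge[of k t] N_cong[OF that]
      by (auto simp: p_def intro: agree_mono)
    then show ?thesis by (blast intro: agree_sym agree_trans)
  qed
  moreover have "inj \<theta>"
  proof (rule injI, rule ccontr)
    fix s t assume eq: "\<theta> s = \<theta> t" and "s \<noteq> t"
    then obtain k where k: "agree k s t" "s k \<noteq> t k"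
      using first_difference[OF \<open>s \<noteq> t\<close>] by blast
    obtain b where b: "R (N t k) b" "\<And>s. agree k s t \<Longrightarrow> N s (Suc k) = b (s k)"
      using N_R by blast
    obtain l where l: "\<And>i. fst (b i) = l" "\<not> agree l (snd (b False)) (snd (b True))"
      using b(1) unfolding R_def by blast
    have "N s (Suc k) = b (s k)" "N t (Suc k) = b (t k)"
      using b(2) k(1) by auto
    then have "agree l (snd (b (s k))) (\<theta> s)" "agree l (snd (b (t k))) (\<theta> t)"
      using \<theta>[of s "Suc k"] \<theta>[of t "Suc k"] l(1) by (auto simp: n_def p_def)
    then have "agree l (snd (b (s k))) (snd (b (t k)))"
      using eq by (metis agree_sym agree_trans)
    then show False
      using l(2) k(2) by (cases "s k"; cases "t k") (auto dest: agree_sym)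
  qed
  ultimately show ?thesis by blast
qed

section \<open>Measurability with respect to cubes\<close>

definition cube_measurable :: "(nat \<Rightarrow> nat \<Rightarrow> bool) set \<Rightarrow> bool" where
  "cube_measurable A \<longleftrightarrow> (\<forall>T\<in>cubing. \<exists>S\<in>cubing. range (T \<circ> S) \<subseteq> A \<or> range (T \<circ> S) \<subseteq> - A)"

lemma cube_measurable_pullback:
  assumes "cube_measurable A" "T \<in> cubing"
  shows "cube_measurable (T -` A)"
  unfolding cube_measurable_def
proof
  fix R assume "R \<in> cubing"
  then have "T \<circ> R \<in> cubing" using assms(2) by (simp only: comp_cubing)
  then obtain S where S: "S \<in> cubing" "range (T \<circ> R \<circ> S) \<subseteq> A \<or> range (T \<circ> R \<circ> S) \<subseteq> - A"
    using assms(1) unfolding cube_measurable_def by blast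
  have "range (R \<circ> S) \<subseteq> T -` A \<or> range (R \<circ> S) \<subseteq> - (T -` A)"
    using S(2) by (auto simp: image_subset_iff)
  with S(1) show "\<exists>S\<in>cubing. range (R \<circ> S) \<subseteq> T -` A \<or> range (R \<circ> S) \<subseteq> - (T -` A)"
    by blast
qed

text \<open>
  The sets that can be avoided by shrinking any cube form a \<open>\<sigma>\<close>-ideal, by fusion. A measurable
  set containing no cube is of this kind, and the whole space is not.
\<close>

lemma countable_cover_contains_cube:
  fixes A :: "nat \<Rightarrow> (nat \<Rightarrow> nat \<Rightarrow> bool) set"
  assumes meas: "\<And>k. cube_measurable (A k)" and cover: "(\<Union>k. A k) = UNIV"
  obtains T k where "T \<in> cubing" "range T \<subseteq> A k"
proof (rule ccontr)
  assume "\<not> thesis"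
  then have none: "\<not> range T \<subseteq> A k" if "T \<in> cubing" for T k
    using that \<open>\<And>T k. T \<in> cubing \<Longrightarrow> range T \<subseteq> A k \<Longrightarrow> thesis\<close> by blast
  have "cofinal (\<lambda>B. B \<inter> A k = {})" for k
    unfolding cofinal_def
  proof
    fix T assume T: "T \<in> cubing"
    then obtain S where S: "S \<in> cubing" "range (T \<circ> S) \<subseteq> A k \<or> range (T \<circ> S) \<subseteq> - A k"
      using meas unfolding cube_measurable_def by blast
    with none[OF comp_cubing[OF T S(1)]] have "range (T \<circ> S) \<inter> A k = {}" by blast
    with S(1) show "\<exists>S\<in>cubing. range (T \<circ> S) \<inter> A k = {}" by blast
  qed
  then have cof: "\<And>k. cofinal (\<lambda>B. B \<inter> A k = {})" .
  have her: "\<And>k. hereditary (\<lambda>B. B \<inter> A k = {})"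
    unfolding hereditary_def by blast
  obtain T where "T \<in> cubing" and T: "\<And>k x. T ` {y. near k x y} \<inter> A k = {}"
    using fusion[of "\<lambda>k B. B \<inter> A k = {}", OF her cof] by blast
  have "T undefined \<notin> A k" for k
    using T[of k undefined] near_refl[of k undefined] by blast
  with cover show False by blast
qed

text \<open>
  Choose representatives by recursion along a well-order of the index set of least order type: every
  proper initial segment is smaller than the sets, so it cannot exhaust any of them.
\<close>

lemma distinct_representatives:
  fixes A :: "'i \<Rightarrow> 'b set"
  assumes "\<And>i. (UNIV :: 'i set) \<lesssim> A i"
  shows "\<exists>h. inj h \<and> (\<forall>i. h i \<in> A i)"
proof -
  let ?r = "card_of (UNIV :: 'i set)"
  have wo: "well_order_on UNIV ?r" and field: "Field ?r = UNIV"
    by (simp_all only: card_of_well_order_on Field_card_of)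
  have "wf (?r - Id)"
    using wo unfolding well_order_on_def by blast
  have "\<exists>h. \<forall>i. h i \<in> A i \<and> (\<forall>j. (j, i) \<in> ?r - Id \<longrightarrow> h i \<noteq> h j)"
  proof (rule dependent_wf_choice[OF \<open>wf (?r - Id)\<close>])
    fix i :: 'i and h :: "'i \<Rightarrow> 'b"
    let ?U = "{j. (j, i) \<in> ?r - Id}"
    have "\<not> A i \<subseteq> h ` ?U"
    proof
      assume "A i \<subseteq> h ` ?U"
      then have "(UNIV :: 'i set) \<lesssim> h ` ?U"
        using assms lepoll_trans subset_imp_lepoll by blast
      then have "(UNIV :: 'i set) \<lesssim> ?U"
        using image_lepoll lepoll_trans by blast
      then have "(card_of (UNIV :: 'i set), card_of ?U) \<in> ordLeq"
        unfolding lepoll_def using card_of_ordLeq by blast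
      moreover have "underS ?r i = ?U"
        by (auto simp: underS_def)
      moreover have "(card_of (underS ?r i), ?r) \<in> ordLess"
        using card_of_underS[OF card_of_Card_order, of i "UNIV :: 'i set"] field
        by simp
      ultimately show False
        using not_ordLess_ordLeq by metis
    qed
    then show "\<exists>v. v \<in> A i \<and> (\<forall>j. (j, i) \<in> ?r - Id \<longrightarrow> v \<noteq> h j)" by blast
  qed auto
  then obtain h where h: "\<And>i. h i \<in> A i" "\<And>i j. (j, i) \<in> ?r - Id \<Longrightarrow> h i \<noteq> h j" by blast
  have "total_on UNIV ?r"
    using wo field unfolding well_order_on_def linear_order_on_def by metis
  then have "inj h"
    unfolding total_on_def by (intro injI) (metis DiffI UNIV_I h(2) pair_in_Id_conv)
  with h(1) show ?thesis by blast
qed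

text \<open>
  A cubing is determined by its values on constant families of eventually false sequences, which amounts to
  countably many bits.
\<close>

lemma cubings_indexed_by_bool_sequences:
  "\<exists>\<phi> :: (nat \<Rightarrow> bool) \<Rightarrow> (nat \<Rightarrow> nat \<Rightarrow> bool) \<Rightarrow> nat \<Rightarrow> nat \<Rightarrow> bool. cubing \<subseteq> range \<phi>"
proof -
  define pad :: "bool list \<Rightarrow> nat \<Rightarrow> bool" where "pad l j \<longleftrightarrow> j < length l \<and> l ! j" for l j
  define code where "code T q = (case from_nat q :: nat \<times> bool list \<times> nat of
      (m, l, i) \<Rightarrow> T (\<lambda>_. pad l) m i)" for T :: "(nat \<Rightarrow> nat \<Rightarrow> bool) \<Rightarrow> nat \<Rightarrow> nat \<Rightarrow> bool" and q :: nat
  have "inj_on code cubing"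
  proof (rule inj_onI)
    fix S T assume S: "S \<in> cubing" and T: "T \<in> cubing" and eq: "code S = code T"
    have "S x m i = T x m i" for x m i
    proof -
      define l where "l = map (x m) [0..<Suc i]"
      have l: "agree (Suc i) (x m) (pad l)"
        by (simp add: agree_def pad_def l_def del: upt_Suc)
      have "agree (Suc i) (S x m) (S (\<lambda>_. pad l) m)" "agree (Suc i) (T x m) (T (\<lambda>_. pad l) m)"
        using cubing_agree[OF S, of "Suc i" x m "\<lambda>_. pad l"]
          cubing_agree[OF T, of "Suc i" x m "\<lambda>_. pad l"] l by blast+
      then have "S x m i = S (\<lambda>_. pad l) m i" "T x m i = T (\<lambda>_. pad l) m i"
        by (simp_all add: agree_def)
      moreover have "S (\<lambda>_. pad l) m i = T (\<lambda>_. pad l) m i"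
        using fun_cong[OF eq, of "to_nat (m, l, i)"] by (simp add: code_def)
      ultimately show ?thesis by simp
    qed
    then show "S = T" by (intro ext)
  qed
  then have "cubing \<subseteq> range (inv_into cubing code)"
    by (metis inv_into_f_f rangeI subsetI)
  then show ?thesis by blast
qed

text \<open>
  Suppose the function is constant on no cube. After fusion it is continuous in a parametrization
  \<open>T\<close>, and on any subcube its range is compact without isolated points, hence as large as the
  set of all cubings. A Bernstein set \<open>B\<close> then meets, and omits a point of, the image of each subcube;
  this contradicts measurability of the preimage of \<open>B\<close>.
\<close>

lemma constant_on_cube_if_bool_sequence_valued:
  fixes g :: "(nat \<Rightarrow> nat \<Rightarrow> bool) \<Rightarrow> (nat \<Rightarrow> bool)"
  assumes meas: "\<And>B. cube_measurable (g -` B)"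
  shows "\<exists>T\<in>cubing. \<exists>c. \<forall>x. g (T x) = c"
proof (rule ccontr)
  assume "\<not> ?thesis"
  then have nonconst: "\<exists>x. g (T x) \<noteq> c" if "T \<in> cubing" for T c
    using that by blast
  define P where "P n A \<longleftrightarrow> (\<forall>x\<in>A. \<forall>y\<in>A. g x n = g y n)" for n A
  have "hereditary (P n)" for n
    unfolding hereditary_def P_def by blast
  moreover have "cofinal (P n)" for n
    unfolding cofinal_def
  proof
    fix T assume "T \<in> cubing"
    then obtain S where S: "S \<in> cubing"
        "range (T \<circ> S) \<subseteq> g -` {y. y n} \<or> range (T \<circ> S) \<subseteq> - (g -` {y. y n})"
      using meas unfolding cube_measurable_def by blast
    then have "P n (range (T \<circ> S))"
      unfolding P_def by auto
    with S(1) show "\<exists>S\<in>cubing. P n (range (T \<circ> S))" by blast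
  qed
  ultimately obtain T where T: "T \<in> cubing" "\<And>n x. P n (T ` {y. near n x y})"
    using fusion by blast
  define G where "G x = g (T x)" for x
  have G_near: "agree n (G x) (G y)" if "near n x y" for n x y
    unfolding agree_def
  proof (intro allI impI)
    fix i assume "i < n"
    then have "near i x y" using that near_mono by simp
    then show "G x i = G y i"
      using T(2)[of i x] near_refl unfolding P_def G_def by blast
  qed
  have large: "(UNIV :: (nat \<Rightarrow> bool) set) \<lesssim> range (G \<circ> R)" if R: "R \<in> cubing" for R
  proof -
    have crowded: "\<exists>y\<in>range (G \<circ> R). y \<noteq> z \<and> agree n z y" if "z \<in> range (G \<circ> R)" for z n
    proof -
      obtain x where z: "z = G (R x)" using \<open>z \<in> range (G \<circ> R)\<close> by auto
      have "T \<circ> (R \<circ> graft n x) \<in> cubing"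
        by (intro comp_cubing T(1) R graft_cubing)
      from nonconst[OF this, of z] obtain y where "G (R (graft n x y)) \<noteq> z"
        by (auto simp: G_def)
      moreover have "agree n z (G (R (graft n x y)))"
        unfolding z by (intro G_near cubing_near[OF R] graft_near)
      ultimately show ?thesis by auto
    qed
    have closed: "closed (range (G \<circ> R))"
      by (rule closed_range_if_near_agree) (simp add: G_near cubing_near[OF R])
    have "\<exists>\<theta>. range \<theta> \<subseteq> range (G \<circ> R) \<and> inj \<theta> \<and>
        (\<forall>n s t. agree n s t \<longrightarrow> agree n (\<theta> s) (\<theta> t))"
      by (rule Lipschitz_injection_into_perfect_set) (simp, fact closed, rule crowded)
    then show ?thesis unfolding lepoll_def by blast
  qed
  obtain \<phi> :: "(nat \<Rightarrow> bool) \<Rightarrow> (nat \<Rightarrow> nat \<Rightarrow> bool) \<Rightarrow> nat \<Rightarrow> nat \<Rightarrow> bool"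
    where \<phi>: "cubing \<subseteq> range \<phi>"
    using cubings_indexed_by_bool_sequences by blast
  \<comment> \<open>Indices naming no cubing are redirected to the identity, so that every index names a cubing.\<close>
  define \<psi> where "\<psi> c = (if \<phi> c \<in> cubing then \<phi> c else id)" for c
  have \<psi>: "\<psi> c \<in> cubing" for c
    by (cases "\<phi> c \<in> cubing") (simp_all only: \<psi>_def if_True if_False id_cubing)
  have "\<exists>h. inj h \<and> (\<forall>c. h c \<in> range (G \<circ> \<psi> (\<lambda>i. c (Suc i))))"
    by (rule distinct_representatives) (rule large[OF \<psi>])
  then obtain h :: "(nat \<Rightarrow> bool) \<Rightarrow> (nat \<Rightarrow> bool)"
    where h: "inj h" "\<And>c. h c \<in> range (G \<circ> \<psi> (\<lambda>i. c (Suc i)))"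
    by blast
  \<comment> \<open>The tail of \<open>c\<close> names a cubing and its first bit says on which side the representative is put,
      so each cubing has one value inside \<open>B\<close> and one outside.\<close>
  define B where "B = h ` {c. c 0}"
  obtain R where R: "R \<in> cubing" "range (T \<circ> R) \<subseteq> g -` B \<or> range (T \<circ> R) \<subseteq> - (g -` B)"
    using meas[of B] T(1) unfolding cube_measurable_def by blast
  obtain c where c: "\<psi> c = R"
    using R(1) \<phi> unfolding \<psi>_def by (metis rangeE subsetD)
  have h_in: "h (case_nat b c) \<in> range (G \<circ> R)" for b
    using h(2)[of "case_nat b c"] c by simp
  have "h (case_nat True c) \<in> B" unfolding B_def by (rule imageI) simp
  moreover have "h (case_nat False c) \<notin> B"
    unfolding B_def by (auto dest!: injD[OF h(1)])
  ultimately show False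
    using h_in[of True] h_in[of False] R(2) unfolding G_def by (auto simp: image_subset_iff)
qed

text \<open>
  The range is no larger than the domain, so its values can be coded injectively by bit sequences.
\<close>

theorem constant_on_cube:
  fixes g :: "(nat \<Rightarrow> nat \<Rightarrow> bool) \<Rightarrow> 'b"
  assumes meas: "\<And>B. cube_measurable (g -` B)"
  shows "\<exists>T\<in>cubing. \<exists>c. \<forall>x. g (T x) = c"
proof -
  define e where "e z q = (case prod_decode q of (m, i) \<Rightarrow> inv g z m i)" for z q
  have inj: "z = z'" if "z \<in> range g" "z' \<in> range g" "e z = e z'" for z z'
  proof -
    have "inv g z m i = inv g z' m i" for m i
      using fun_cong[OF that(3), of "prod_encode (m, i)"] by (simp add: e_def)
    then have "inv g z = inv g z'" by (intro ext)
    then show ?thesis using that by (metis f_inv_into_f)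
  qed
  have "cube_measurable ((e \<circ> g) -` B)" for B
    using meas[of "e -` B"] by (simp add: vimage_comp)
  then obtain T c where T: "T \<in> cubing" "\<And>x. e (g (T x)) = c"
    using constant_on_cube_if_bool_sequence_valued[of "e \<circ> g"] by auto
  have "g (T x) = g (T undefined)" for x
    by (rule inj) (auto simp: T(2))
  with T(1) show ?thesis by blast
qed

section \<open>Continuity on a cube\<close>

text \<open>
  Without separability the space need not be a countable union of \<open>\<epsilon>\<close>-balls. Instead the layers
  \<open>E k UNIV\<close> cover it, where \<open>E k S\<close> consists of the points with first centre \<open>idx z\<close> in \<open>S\<close>
  whose \<open>\<delta> k\<close>-ball lies in the \<open>\<epsilon>\<close>-ball of that centre. Of two points of a layer at
  distance less than \<open>\<delta> k\<close>, each lies in the \<open>\<epsilon>\<close>-ball of the other's centre, so neither centre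
  precedes the other. Hence \<open>idx\<close>
  is locally constant on a layer, uniformly, and each \<open>E k S\<close> is closed.
\<close>

lemma (in Metric_space) small_image_on_cube:
  assumes F_in: "\<And>x. F x \<in> M"
    and meas: "\<And>U. openin mtopology U \<Longrightarrow> cube_measurable (F -` U)"
    and "\<epsilon> > 0"
  shows "\<exists>T\<in>cubing. \<exists>y\<in>M. range (F \<circ> T) \<subseteq> mball y \<epsilon>"
proof -
  obtain r where wo: "well_order_on (UNIV :: 'a set) r"
    using well_order_on by blast
  have wf: "wf (r - Id)" and tot: "total_on UNIV r"
    using wo unfolding well_order_on_def linear_order_on_def by auto
  have "\<exists>y. z \<in> mball y \<epsilon> \<and> (\<forall>y'. z \<in> mball y' \<epsilon> \<longrightarrow> (y', y) \<notin> r - Id)" if "z \<in> M" for z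
  proof -
    have "z \<in> {y. z \<in> mball y \<epsilon>}" using that \<open>\<epsilon> > 0\<close> by simp
    from wfE_min[OF wf this] show ?thesis by (metis mem_Collect_eq)
  qed
  then obtain idx where idx: "\<And>z. z \<in> M \<Longrightarrow> z \<in> mball (idx z) \<epsilon>"
    and idx_min: "\<And>z y. z \<in> M \<Longrightarrow> z \<in> mball y \<epsilon> \<Longrightarrow> (y, idx z) \<notin> r - Id"
    by metis
  have idx_eq: "idx z = idx w"
    if "z \<in> M" "w \<in> M" "z \<in> mball (idx w) \<epsilon>" "w \<in> mball (idx z) \<epsilon>" for z w
    using idx_min[OF that(1,3)] idx_min[OF that(2,4)] tot
    unfolding total_on_def by (metis DiffI UNIV_I pair_in_Id_conv)
  define \<delta> where "\<delta> k = inverse (real (Suc k))" for k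
  have \<delta>_pos: "\<delta> k > 0" for k by (simp add: \<delta>_def)
  define E where "E k S = {z \<in> M. idx z \<in> S \<and> mball z (\<delta> k) \<subseteq> mball (idx z) \<epsilon>}" for k S
  have E_closed: "closedin mtopology (E k S)" for k S
  proof -
    have "mtopology closure_of E k S \<subseteq> E k S"
    proof
      fix z assume "z \<in> mtopology closure_of E k S"
      then have zM: "z \<in> M" and lim: "\<And>e. e > 0 \<Longrightarrow> \<exists>w\<in>E k S. w \<in> mball z e"
        by (auto simp: metric_closure_of)
      obtain w where w: "w \<in> E k S" "d z w < \<delta> k / 2"
        using lim[of "\<delta> k / 2"] \<delta>_pos by auto
      have wM: "w \<in> M" and w_ball: "mball w (\<delta> k) \<subseteq> mball (idx w) \<epsilon>"
        using w(1) by (auto simp: E_def)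
      have same: "idx v = idx w" if v: "v \<in> E k S" "d z v < \<delta> k / 2" for v
      proof -
        have vM: "v \<in> M" and v_ball: "mball v (\<delta> k) \<subseteq> mball (idx v) \<epsilon>"
          using v(1) by (auto simp: E_def)
        have "d v w < \<delta> k"
          using triangle[OF vM zM wM] w(2) v(2) commute[of v z] by linarith
        then have "w \<in> mball v (\<delta> k)" "v \<in> mball w (\<delta> k)"
          using vM wM by (auto simp: commute)
        then show ?thesis
          using idx_eq[OF vM wM] v_ball w_ball by blast
      qed
      have z_ball: "mball z (\<delta> k) \<subseteq> mball (idx w) \<epsilon>"
      proof
        fix p assume p: "p \<in> mball z (\<delta> k)"
        then have pM: "p \<in> M" and dp: "d z p < \<delta> k" by auto
        obtain v where v: "v \<in> E k S" "v \<in> mball z (min (\<delta> k / 2) (\<delta> k - d z p))"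
          using lim[of "min (\<delta> k / 2) (\<delta> k - d z p)"] \<delta>_pos[of k] dp by auto
        then have vM: "v \<in> M" and dv: "d z v < \<delta> k / 2" "d z v < \<delta> k - d z p" by auto
        have "d v p < \<delta> k"
          using triangle[OF vM zM pM] dv(2) commute[of v z] by linarith
        then have "p \<in> mball (idx v) \<epsilon>"
          using v(1) vM pM by (auto simp: E_def)
        then show "p \<in> mball (idx w) \<epsilon>"
          using same[OF v(1) dv(1)] by simp
      qed
      have z_in: "z \<in> mball (idx w) \<epsilon>"
        using z_ball zM \<delta>_pos[of k] by auto
      have "openin mtopology (mball (idx z) \<epsilon>)" "z \<in> mball (idx z) \<epsilon>"
        using idx[OF zM] by auto
      then obtain e where e: "e > 0" "mball z e \<subseteq> mball (idx z) \<epsilon>"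
        unfolding openin_mtopology by blast
      \<comment> \<open>A point \<open>v\<close> of the layer close to \<open>z\<close> lies in the \<open>\<epsilon>\<close>-ball of the centre of \<open>z\<close>,
          and \<open>z\<close> lies in that of the centre of \<open>v\<close>, so the two centres coincide.\<close>
      obtain v where v: "v \<in> E k S" "v \<in> mball z (min (\<delta> k / 2) e)"
        using lim[of "min (\<delta> k / 2) e"] \<delta>_pos[of k] e(1) by auto
      then have vM: "v \<in> M" and "v \<in> mball (idx z) \<epsilon>" and "idx v = idx w"
        using e(2) same[of v] by auto
      then have "idx z = idx w"
        using idx_eq[OF zM vM] z_in by simp
      then show "z \<in> E k S"
        using w(1) zM z_ball by (simp add: E_def)
    qed
    then show ?thesis
      by (intro closure_of_subset_eq[THEN iffD1]) (auto simp: E_def)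
  qed
  have meas_E: "cube_measurable (F -` E k S)" for k S
  proof -
    have "openin mtopology (M - E k S)"
      using E_closed openin_diff[OF openin_topspace] by (metis topspace_mtopology)
    then have "cube_measurable (F -` (M - E k S))" by (rule meas)
    moreover have "F -` (M - E k S) = - (F -` E k S)"
      using F_in by auto
    ultimately show ?thesis
      unfolding cube_measurable_def by (metis double_compl)
  qed
  have "(\<Union>k. F -` E k UNIV) = UNIV"
  proof -
    have "\<exists>k. F x \<in> E k UNIV" for x
    proof -
      have "openin mtopology (mball (idx (F x)) \<epsilon>)" "F x \<in> mball (idx (F x)) \<epsilon>"
        using idx[OF F_in] by auto
      then obtain e where e: "e > 0" "mball (F x) e \<subseteq> mball (idx (F x)) \<epsilon>"
        unfolding openin_mtopology by blast
      obtain k where "\<delta> k < e"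
        using reals_Archimedean[OF e(1)] by (auto simp: \<delta>_def)
      then have "mball (F x) (\<delta> k) \<subseteq> mball (idx (F x)) \<epsilon>"
        using e(2) mball_subset_concentric[of "\<delta> k" e "F x"] by auto
      then show ?thesis using F_in by (auto simp: E_def)
    qed
    then show ?thesis by auto
  qed
  then obtain T k where T: "T \<in> cubing" "range T \<subseteq> F -` E k UNIV"
    using countable_cover_contains_cube[of "\<lambda>k. F -` E k UNIV"] meas_E by metis
  have "cube_measurable ((\<lambda>x. idx (F (T x))) -` S)" for S
  proof -
    have "T -` (F -` E k S) = (\<lambda>x. idx (F (T x))) -` S"
      using T(2) by (auto simp: E_def)
    then show ?thesis
      using cube_measurable_pullback[OF meas_E T(1)] by metis
  qed
  then obtain R c where R: "R \<in> cubing" "\<And>x. idx (F (T (R x))) = c"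
    using constant_on_cube[of "\<lambda>x. idx (F (T x))"] by blast
  have in_ball: "F (T (R x)) \<in> mball c \<epsilon>" for x
    using idx[OF F_in[of "T (R x)"]] by (simp only: R(2))
  then have "range (F \<circ> (T \<circ> R)) \<subseteq> mball c \<epsilon>" by auto
  moreover have "c \<in> M" using in_ball[of undefined] by auto
  ultimately show ?thesis
    using comp_cubing[OF T(1) R(1)] by blast
qed

text \<open>
  One fusion handles all functions \<open>F n\<close> and radii \<open>1 / (j + 1)\<close> simultaneously, through the coding of the
  pair \<open>(n, j)\<close> by a natural number. Small oscillation on boxes of the corresponding level is continuity.
\<close>

lemma (in Metric_space) continuous_on_cube:
  assumes F_in: "\<And>n x. F n x \<in> M"
    and meas: "\<And>n U. openin mtopology U \<Longrightarrow> cube_measurable (F n -` U)"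
  shows "\<exists>T\<in>cubing. \<forall>n::nat. continuous_map euclidean mtopology (F n \<circ> T)"
proof -
  define P where "P q A = (case prod_decode q of (n, j) \<Rightarrow>
      \<exists>y\<in>M. F n ` A \<subseteq> mball y (inverse (real (Suc j))))" for q A
  have her: "hereditary (P q)" for q
    unfolding hereditary_def P_def by (cases "prod_decode q") (simp, blast)
  have cof: "cofinal (P q)" for q
    unfolding cofinal_def
  proof
    fix T assume T: "T \<in> cubing"
    obtain n j where q: "prod_decode q = (n, j)" by fastforce
    have "cube_measurable ((F n \<circ> T) -` U)" if "openin mtopology U" for U
      using cube_measurable_pullback[OF meas[OF that] T] by (simp add: vimage_comp)
    then obtain S y where S: "S \<in> cubing" "y \<in> M"
        "range (F n \<circ> T \<circ> S) \<subseteq> mball y (inverse (real (Suc j)))"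
      using small_image_on_cube[of "F n \<circ> T" "inverse (real (Suc j))"] F_in by auto
    then have "F n ` range (T \<circ> S) \<subseteq> mball y (inverse (real (Suc j)))"
      by (simp add: image_comp comp_assoc)
    then have "P q (range (T \<circ> S))"
      unfolding P_def q using S(2) by auto
    with S(1) show "\<exists>S\<in>cubing. P q (range (T \<circ> S))" by blast
  qed
  obtain T where T: "T \<in> cubing" "\<And>q x. P q (T ` {y. near q x y})"
    using fusion[of P, OF her cof] by blast
  have "continuous_map euclidean mtopology (F n \<circ> T)" for n
  proof (rule continuous_map_nearI)
    fix x U assume "openin mtopology U" "(F n \<circ> T) x \<in> U"
    then obtain e where e: "e > 0" "mball (F n (T x)) e \<subseteq> U"
      unfolding openin_mtopology by auto
    obtain j where j: "inverse (real (Suc j)) < e / 2"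
      using reals_Archimedean[of "e / 2"] e(1) by auto
    define q where "q = prod_encode (n, j)"
    obtain y where y: "y \<in> M" "F n ` T ` {z. near q x z} \<subseteq> mball y (inverse (real (Suc j)))"
      using T(2)[of q x] by (auto simp: P_def q_def)
    have "F n (T z) \<in> U" if "near q x z" for z
    proof -
      have "F n (T x) \<in> mball y (inverse (real (Suc j)))"
        "F n (T z) \<in> mball y (inverse (real (Suc j)))"
        using y(2) that near_refl[of q x] by blast+
      then have "d (F n (T x)) (F n (T z)) < e"
        using triangle[OF F_in[of n "T x"] y(1) F_in[of n "T z"]] j commute[of y "F n (T x)"]
        by auto
      then show ?thesis using e(2) F_in by auto
    qed
    then show "\<exists>q. \<forall>z. near q x z \<longrightarrow> (F n \<circ> T) z \<in> U" by auto
  qed (simp add: F_in)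
  with T(1) show ?thesis by blast
qed

section \<open>Cantor sets in Polish spaces and transfer of measurability\<close>

text \<open>
  A Cantor scheme of closed balls: each ball contains two disjoint balls of at most half its radius, because
  its centre is not isolated. Completeness provides a point on every branch.
\<close>

lemma (in Metric_space) Cantor_injection:
  assumes compl: "mcomplete" and ne: "M \<noteq> {}" and crowded: "M \<subseteq> mtopology derived_set_of M"
  shows "\<exists>u :: (nat \<Rightarrow> bool) \<Rightarrow> 'a. continuous_map euclidean mtopology u \<and> inj u"
proof -
  obtain x0 where x0: "x0 \<in> M" using ne by blast
  define P where "P a \<longleftrightarrow> fst a \<in> M \<and> snd a > 0" for a :: "'a \<times> real"
  define R where "R a b \<longleftrightarrow> (\<forall>i. mcball (fst (b i)) (snd (b i)) \<subseteq> mcball (fst a) (snd a) \<and>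
      snd (b i) \<le> snd a / 2) \<and>
      mcball (fst (b False)) (snd (b False)) \<inter> mcball (fst (b True)) (snd (b True)) = {}"
    for a :: "'a \<times> real" and b :: "bool \<Rightarrow> 'a \<times> real"
  have child: "\<exists>b. (\<forall>i. P (b i)) \<and> R a b" if a: "P a" for a
  proof -
    obtain x r where a_eq: "a = (x, r)" by fastforce
    with a have x: "x \<in> M" and r: "r > 0" by (auto simp: P_def)
    have "x \<in> mtopology derived_set_of M" using crowded x by blast
    then have "\<forall>r>0. \<exists>y\<in>M. y \<noteq> x \<and> y \<in> mball x r"
      unfolding metric_derived_set_of by blast
    moreover have "r / 2 > 0" using r by simp
    ultimately obtain y where "y \<noteq> x" "y \<in> mball x (r / 2)" by blast
    then have y: "y \<in> M" "y \<noteq> x" "d x y < r / 2" by auto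
    \<comment> \<open>A third of the distance keeps the closed balls around the two centres disjoint.\<close>
    define s where "s = min (r / 2) (d x y / 3)"
    have dxy: "d x y > 0" using x y by simp
    have s: "s > 0" "s \<le> r / 2" "s \<le> d x y / 3"
      using r dxy by (auto simp: s_def)
    define b where "b i = (if i then y else x, s)" for i
    have "mcball y s \<subseteq> mcball x r"
    proof
      fix z assume "z \<in> mcball y s"
      then show "z \<in> mcball x r"
        using triangle[OF x y(1), of z] x y(3) s(2) by auto
    qed
    moreover have "mcball x s \<subseteq> mcball x r"
      using s(2) r by (intro mcball_subset_concentric) auto
    moreover have "mcball x s \<inter> mcball y s = {}"
    proof -
      have False if "z \<in> mcball x s" "z \<in> mcball y s" for z
        using that triangle[OF x _ y(1), of z] s(3) dxy commute[of z y] by auto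
      then show ?thesis by blast
    qed
    ultimately have "R a b"
      using s(2) unfolding R_def b_def a_eq by auto
    moreover have "\<forall>i. P (b i)"
      using x y s(1) by (simp add: P_def b_def)
    ultimately show ?thesis by blast
  qed
  have root: "P (x0, 1)" using x0 by (simp add: P_def)
  obtain N where N_P: "\<And>t k. P (N t k)"
    and N_cong: "\<And>k s t. agree k s t \<Longrightarrow> N s k = N t k"
    and N_R: "\<And>k t. \<exists>b. R (N t k) b \<and> (\<forall>s. agree k s t \<longrightarrow> N s (Suc k) = b (s k))"
    using binary_branches[of P "(x0, 1)" R, OF root child] by blast
  define B where "B t k = mcball (fst (N t k)) (snd (N t k))" for t k
  have nested: "B t (Suc k) \<subseteq> B t k \<and> snd (N t (Suc k)) \<le> snd (N t k) / 2" for t k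
  proof -
    obtain b where "R (N t k) b" "N t (Suc k) = b (t k)"
      using N_R[of t k] agree_refl by blast
    then show ?thesis unfolding B_def R_def by auto
  qed
  have radius: "\<exists>k. snd (N t k) < e" if "e > 0" for t e
  proof -
    have bound: "snd (N t k) \<le> snd (N t 0) * (1 / 2) ^ k" for k
    proof (induction k)
      case (Suc k)
      then show ?case using nested[of t k] by simp
    qed simp
    have pos: "snd (N t 0) > 0" using N_P by (simp add: P_def)
    then obtain k where "(1 / 2) ^ k < e / snd (N t 0)"
      using real_arch_pow_inv[of "e / snd (N t 0)" "1 / 2"] \<open>e > 0\<close> by auto
    then have "snd (N t 0) * (1 / 2) ^ k < e"
      using pos by (simp add: field_simps)
    with bound[of k] show ?thesis by (intro exI[of _ k]) linarith
  qed
  have inter: "\<Inter> (range (B t)) \<noteq> {}" for t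
  proof -
    have "closedin mtopology (B t k)" for k
      by (simp add: B_def)
    moreover have "fst (N t k) \<in> B t k" for k
      using N_P[of t k] by (simp add: B_def P_def)
    then have "B t k \<noteq> {}" for k by blast
    moreover have "decseq (B t)"
      using nested by (intro decseq_SucI) (rule conjunct1)
    moreover have "\<exists>k a. B t k \<subseteq> mcball a e" if "e > 0" for e
    proof -
      obtain k where "snd (N t k) < e" using radius[OF \<open>e > 0\<close>] by blast
      then have "B t k \<subseteq> mcball (fst (N t k)) e"
        unfolding B_def by (intro mcball_subset_concentric) simp
      then show ?thesis by blast
    qed
    ultimately show ?thesis
      using compl[unfolded mcomplete_nest, THEN spec, of "B t"] by blast
  qed
  have "\<exists>z. \<forall>k. z \<in> B t k" for t using inter[of t] by blast
  then obtain u where u: "\<And>t k. u t \<in> B t k" by metis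
  have "continuous_map euclidean mtopology u"
  proof (rule continuous_map_agreeI)
    fix t
    show "u t \<in> topspace mtopology" using u[of t 0] by (auto simp: B_def)
  next
    fix t U assume "openin mtopology U" "u t \<in> U"
    then obtain e where e: "e > 0" "mball (u t) e \<subseteq> U"
      unfolding openin_mtopology by blast
    obtain k where k: "snd (N t k) < e / 2" using radius[of "e / 2" t] e(1) by auto
    have "u s \<in> U" if "agree k t s" for s
    proof -
      have eq: "N s k = N t k" using N_cong[OF that] by simp
      have "u s \<in> mcball (fst (N t k)) (snd (N t k))" "u t \<in> mcball (fst (N t k)) (snd (N t k))"
        using u[of s k] u[of t k] eq by (simp_all add: B_def)
      then have M: "u s \<in> M" "u t \<in> M" "fst (N t k) \<in> M"
        and "d (fst (N t k)) (u s) < e / 2" "d (u t) (fst (N t k)) < e / 2"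
        using k by (auto simp: commute)
      then have "d (u t) (u s) < e"
        using triangle[OF M(2,3,1)] by linarith
      then show ?thesis using e(2) M by auto
    qed
    then show "\<exists>k. \<forall>s. agree k t s \<longrightarrow> u s \<in> U" by blast
  qed
  moreover have "inj u"
  proof (rule injI, rule ccontr)
    fix s t assume eq: "u s = u t" and "s \<noteq> t"
    obtain k where k: "agree k s t" "s k \<noteq> t k"
      using first_difference[OF \<open>s \<noteq> t\<close>] by blast
    obtain b where b: "R (N t k) b" "\<And>s. agree k s t \<Longrightarrow> N s (Suc k) = b (s k)"
      using N_R by blast
    have "N s (Suc k) = b (s k)" "N t (Suc k) = b (t k)"
      using b(2) k(1) by auto
    then have "u t \<in> mcball (fst (b (s k))) (snd (b (s k))) \<inter> mcball (fst (b (t k))) (snd (b (t k)))"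
      using u[of s "Suc k"] u[of t "Suc k"] eq by (auto simp: B_def)
    then show False
      using b(1) k(2) unfolding R_def by (cases "s k"; cases "t k") auto
  qed
  ultimately show ?thesis by blast
qed

lemma Cantor_injection_into_Polish_space:
  assumes "Polish_space X" "topspace X \<noteq> {}" "no_isolated_points_in X (topspace X)"
  shows "\<exists>u :: (nat \<Rightarrow> bool) \<Rightarrow> 'a. continuous_map euclidean X u \<and> inj u"
proof -
  obtain M d where "Metric_space M d" "Metric_space.mcomplete M d" "X = Metric_space.mtopology M d"
    using assms(1) unfolding Polish_space_def completely_metrizable_space_def by blast
  then show ?thesis
    using assms Metric_space.Cantor_injection[of M d] Metric_space.topspace_mtopology[of M d]
    unfolding no_isolated_points_in_def by metis
qed

text \<open>
  Flipping a single late bit gives, in every neighbourhood of a point of the range, another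
  point of the range.
\<close>

lemma perfect_in_range:
  fixes u :: "(nat \<Rightarrow> bool) \<Rightarrow> 'a"
  assumes "Hausdorff_space X" "continuous_map euclidean X u" "inj u"
  shows "perfect_in X (range u)"
proof -
  have "compactin X (range u)"
    using image_compactin[OF _ assms(2), of UNIV] compact_space_bool_sequences
    by (simp add: compact_space_def del: compactin_euclidean_iff)
  then have "closedin X (range u)"
    by (rule compactin_imp_closedin[OF assms(1)])
  moreover have "u x \<in> X derived_set_of (range u)" for x
    unfolding in_derived_set_of
  proof (intro conjI allI impI)
    show "u x \<in> topspace X"
      using continuous_map_image_subset_topspace[OF assms(2)] by auto
    fix U assume U: "u x \<in> U \<and> openin X U"
    then have "openin euclidean {y \<in> topspace euclidean. u y \<in> U}"
      using openin_continuous_map_preimage[OF assms(2)] by blast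
    then have "open {y. u y \<in> U}" by simp
    then obtain n where n: "{y. agree n x y} \<subseteq> {y. u y \<in> U}"
      using open_contains_agree[of "{y. u y \<in> U}" x] U by blast
    define y where "y = x(n := \<not> x n)"
    have "agree n x y" "y n \<noteq> x n" by (auto simp: y_def agree_def)
    then have "u y \<in> U" "u y \<noteq> u x"
      using n injD[OF assms(3), of y x] by auto
    then show "\<exists>y. y \<noteq> u x \<and> y \<in> range u \<and> y \<in> U" by blast
  qed
  ultimately show ?thesis
    unfolding perfect_in_def no_isolated_points_in_def by blast
qed

text \<open>
  Perfectness is pulled back along \<open>u\<close>. For the absence of isolated points this uses that \<open>u\<close> is an
  embedding: the sequences disagreeing with \<open>x\<close> before \<open>n\<close> form a compact set, whose image can be
  avoided near \<open>u x\<close>.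
\<close>

lemma Lipschitz_injection_into_perfect_in:
  fixes u :: "(nat \<Rightarrow> bool) \<Rightarrow> 'a"
  assumes "Hausdorff_space X" "continuous_map euclidean X u" "inj u"
    and "perfect_in X Q" "Q \<subseteq> range u"
  shows "\<exists>\<theta>. range (u \<circ> \<theta>) \<subseteq> Q \<and> inj \<theta> \<and> (\<forall>n s t. agree n s t \<longrightarrow> agree n (\<theta> s) (\<theta> t))"
proof -
  have "\<exists>\<theta>. range \<theta> \<subseteq> u -` Q \<and> inj \<theta> \<and> (\<forall>n s t. agree n s t \<longrightarrow> agree n (\<theta> s) (\<theta> t))"
  proof (rule Lipschitz_injection_into_perfect_set)
    show "u -` Q \<noteq> {}"
      using assms(4,5) unfolding perfect_in_def by blast
    have "closedin euclidean {y \<in> topspace euclidean. u y \<in> Q}"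
      using closedin_continuous_map_preimage[OF assms(2)] assms(4)
      unfolding perfect_in_def by blast
    then show "closed (u -` Q)" by (simp add: vimage_def)
    fix x n assume x: "x \<in> u -` Q"
    have "closed (- {y. agree n x y})"
      by (rule closed_Compl[OF open_agree])
    then have "compactin euclidean (- {y. agree n x y})"
      by (intro closedin_compact_space[OF compact_space_bool_sequences] closed_closedin[THEN iffD1])
    then have "closedin X (u ` (- {y. agree n x y}))"
      using image_compactin[OF _ assms(2)] compactin_imp_closedin[OF assms(1)] by blast
    then have op: "openin X (topspace X - u ` (- {y. agree n x y}))"
      by blast
    have "u x \<in> X derived_set_of Q"
      using x assms(4) unfolding perfect_in_def no_isolated_points_in_def by blast
    moreover have "u x \<in> topspace X - u ` (- {y. agree n x y})"
      using continuous_map_image_subset_topspace[OF assms(2)] injD[OF assms(3)] agree_refl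
      by fastforce
    ultimately obtain q where q: "q \<noteq> u x" "q \<in> Q" "q \<notin> u ` (- {y. agree n x y})"
      using op unfolding in_derived_set_of by blast
    obtain y where "q = u y" using q(2) assms(5) by blast
    with q show "\<exists>y\<in>u -` Q. y \<noteq> x \<and> agree n x y"
      by (intro bexI[of _ y]) auto
  qed
  then show ?thesis by (simp add: image_subset_iff)
qed

text \<open>
  A cubing followed by the injections \<open>u m\<close> parametrizes a perfect cube in the product. A perfect subcube
  need not come with a parametrization of the right kind, but it contains a smaller cube that does.
\<close>

lemma cube_measurable_of_s_omega:
  fixes X :: "nat \<Rightarrow> 'a topology" and u :: "nat \<Rightarrow> (nat \<Rightarrow> bool) \<Rightarrow> 'a"
  assumes haus: "\<And>m. Hausdorff_space (X m)"
    and cont: "\<And>m. continuous_map euclidean (X m) (u m)" and inj: "\<And>m. inj (u m)"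
    and A: "A \<in> s_omega X"
  shows "cube_measurable ((\<lambda>x m. u m (x m)) -` A)"
  unfolding cube_measurable_def
proof
  fix T assume T: "T \<in> cubing"
  \<comment> \<open>The map through which \<open>T\<close> acts on coordinate \<open>m\<close>.\<close>
  define \<tau> where "\<tau> m z = T (\<lambda>_. z) m" for m z
  have T_\<tau>: "T x m = \<tau> m (x m)" for x m
    unfolding \<tau>_def by (rule cubing_coordinate[OF T]) simp
  define v where "v m = u m \<circ> \<tau> m" for m
  have "continuous_map euclidean euclidean (\<tau> m)" for m
  proof (rule continuous_map_agreeI)
    fix x U assume "openin euclidean U" "\<tau> m x \<in> U"
    then obtain n where "{y. agree n (\<tau> m x) y} \<subseteq> U"
      by (metis open_contains_agree open_openin)
    moreover have "agree n (\<tau> m x) (\<tau> m y)" if "agree n x y" for y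
      unfolding \<tau>_def using cubing_agree[OF T, of n "\<lambda>_. x" m "\<lambda>_. y"] that by simp
    ultimately show "\<exists>n. \<forall>y. agree n x y \<longrightarrow> \<tau> m y \<in> U" by blast
  qed simp
  then have v_cont: "continuous_map euclidean (X m) (v m)" for m
    unfolding v_def using cont continuous_map_compose by blast
  have "inj (\<tau> m)" for m
    unfolding \<tau>_def by (rule injI) (drule cubing_inj[OF T], simp)
  then have v_inj: "inj (v m)" for m
    unfolding v_def using inj by (intro inj_compose)
  have "perfect_cube X (\<Pi>\<^sub>E m\<in>UNIV. range (v m))"
    unfolding perfect_cube_def using perfect_in_range[OF haus v_cont v_inj]
    by (intro exI[of _ "\<lambda>m. range (v m)"]) simp
  then obtain Q where Q: "perfect_cube X Q" "Q \<subseteq> (\<Pi>\<^sub>E m\<in>UNIV. range (v m))"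
      "Q \<subseteq> A \<or> Q \<subseteq> topspace (product_topology X UNIV) - A"
    using A unfolding s_omega_def by blast
  then obtain K where K: "\<And>m. perfect_in (X m) (K m)" "Q = (\<Pi>\<^sub>E m\<in>UNIV. K m)"
    unfolding perfect_cube_def by blast
  have "K m \<noteq> {}" for m using K(1) unfolding perfect_in_def by blast
  then have sub: "K m \<subseteq> range (v m)" for m
    using Q(2) unfolding K(2) PiE_eq_empty_iff subset_PiE by blast
  have "\<exists>\<theta>. range (v m \<circ> \<theta>) \<subseteq> K m \<and> inj \<theta> \<and> (\<forall>n s t. agree n s t \<longrightarrow> agree n (\<theta> s) (\<theta> t))" for m
    by (rule Lipschitz_injection_into_perfect_in[OF haus v_cont v_inj K(1) sub])
  then obtain \<theta> where \<theta>: "\<And>m. range (v m \<circ> \<theta> m) \<subseteq> K m" "\<And>m. inj (\<theta> m)"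
      "\<And>m n s t. agree n s t \<Longrightarrow> agree n (\<theta> m s) (\<theta> m t)"
    by metis
  define S where "S x m = \<theta> m (x m)" for x m
  have "S \<in> cubing"
    by (rule cubingI) (auto simp: S_def intro: \<theta>(3) dest: injD[OF \<theta>(2)])
  moreover have "(\<lambda>m. u m ((T \<circ> S) x m)) \<in> Q" for x
  proof -
    have "u m ((T \<circ> S) x m) = (v m \<circ> \<theta> m) (x m)" for m
      by (simp add: T_\<tau> S_def v_def)
    moreover have "(v m \<circ> \<theta> m) (x m) \<in> K m" for m
      using \<theta>(1) by blast
    ultimately show ?thesis
      unfolding K(2) by (simp add: PiE_UNIV_domain)
  qed
  then have "range (T \<circ> S) \<subseteq> (\<lambda>x m. u m (x m)) -` A \<or> range (T \<circ> S) \<subseteq> - ((\<lambda>x m. u m (x m)) -` A)"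
    using Q(3) by blast
  ultimately show "\<exists>S\<in>cubing. range (T \<circ> S) \<subseteq> (\<lambda>x m. u m (x m)) -` A \<or>
      range (T \<circ> S) \<subseteq> - ((\<lambda>x m. u m (x m)) -` A)"
    by blast
qed

theorem theorem7:
  fixes X :: "nat \<Rightarrow> 'a topology"
    and M :: "'b metric"
    and f :: "nat \<Rightarrow> (nat \<Rightarrow> 'a) \<Rightarrow> 'b"
  assumes "\<And>m. Polish_space (X m)"
    and "\<And>m. topspace (X m) \<noteq> {}"
    and "\<And>m. no_isolated_points_in (X m) (topspace (X m))"
    and "\<And>n. s_omega_measurable X M (f n)"
  shows "\<exists>P. perfect_cube X P \<and>
    (\<forall>n. continuous_map (subtopology (product_topology X UNIV) P) (mtopology_of M) (f n))"
proof -
  interpret M: Metric_space "mspace M" "mdist M" by (rule Metric_space_mspace_mdist)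
  have haus: "Hausdorff_space (X m)" for m
    using assms(1)[of m] unfolding Polish_space_def
    by (blast intro: completely_metrizable_imp_metrizable_space metrizable_imp_Hausdorff_space)
  have "\<exists>u :: (nat \<Rightarrow> bool) \<Rightarrow> 'a. continuous_map euclidean (X m) u \<and> inj u" for m
    by (rule Cantor_injection_into_Polish_space) (fact assms)+
  then obtain u :: "nat \<Rightarrow> (nat \<Rightarrow> bool) \<Rightarrow> 'a"
    where u: "\<And>m. continuous_map euclidean (X m) (u m)" "\<And>m. inj (u m)"
    by metis
  define H where "H x = (\<lambda>m. u m (x m))" for x :: "nat \<Rightarrow> nat \<Rightarrow> bool"
  have H_cont: "continuous_map euclidean (product_topology X UNIV) H"
    unfolding continuous_map_componentwise_UNIV H_def
  proof
    fix m
    have "continuous_map (euclidean :: (nat \<Rightarrow> nat \<Rightarrow> bool) topology) euclidean (\<lambda>x. x m)"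
      using continuous_on_product_coordinates[of m] by simp
    from continuous_map_compose[OF this u(1)[of m]]
    show "continuous_map euclidean (X m) (\<lambda>x. u m (x m))"
      unfolding comp_def .
  qed
  have H_in: "H x \<in> topspace (product_topology X UNIV)" for x
    using continuous_map_image_subset_topspace[OF H_cont] by auto
  have "cube_measurable ((f n \<circ> H) -` U)" if U: "openin M.mtopology U" for n U
  proof -
    have "openin (mtopology_of M) U" using U by (simp add: mtopology_of_def)
    then have "{x \<in> topspace (product_topology X UNIV). f n x \<in> U} \<in> s_omega X" (is "?A \<in> _")
      using assms(4)[of n] unfolding s_omega_measurable_def by blast
    then have "cube_measurable (H -` ?A)"
      unfolding H_def by (rule cube_measurable_of_s_omega[OF haus u])
    moreover have "H -` ?A = (f n \<circ> H) -` U"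
      using H_in by auto
    ultimately show ?thesis by simp
  qed
  moreover have "(f n \<circ> H) x \<in> mspace M" for n x
    using assms(4)[of n] H_in[of x] unfolding s_omega_measurable_def by auto
  ultimately obtain T where T: "T \<in> cubing"
      "\<And>n. continuous_map euclidean M.mtopology (f n \<circ> H \<circ> T)"
    using M.continuous_on_cube[of "\<lambda>n. f n \<circ> H"] by blast
  define v where "v m z = u m (T (\<lambda>_. z) m)" for m z
  define h where "h x = (\<lambda>m. v m (x m))" for x
  have h_eq: "h = H \<circ> T"
  proof (intro ext)
    fix x m
    have "T (\<lambda>_. x m) m = T x m" by (rule cubing_coordinate[OF T(1)]) simp
    then show "h x m = (H \<circ> T) x m" by (simp add: h_def v_def H_def)
  qed
  \<comment> \<open>Continuity of \<open>f n\<close> on the cube is transported along the embedding \<open>h = H \<circ> T\<close> of a compact space.\<close>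
  have T_cont: "continuous_map euclidean euclidean T"
  proof -
    have "continuous_map euclidean (product_topology (\<lambda>_. euclidean) UNIV) T"
      unfolding continuous_map_componentwise_UNIV
    proof (intro allI continuous_map_nearI)
      fix m x U assume "openin euclidean U" "T x m \<in> U"
      then obtain n where n: "{y. agree n (T x m) y} \<subseteq> U"
        by (metis open_contains_agree open_openin)
      have "T y m \<in> U" if "near (max n (Suc m)) x y" for y
      proof -
        have "agree n (x m) (y m)"
          using that unfolding near_def by (meson agree_mono lessI less_max_iff_disj max.cobounded1)
        then have "agree n (T x m) (T y m)"
          by (rule cubing_agree[OF T(1)])
        then show ?thesis using n by blast
      qed
      then show "\<exists>n. \<forall>y. near n x y \<longrightarrow> T y m \<in> U" by blast
    qed simp
    then show ?thesis by (simp only: euclidean_product_topology)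
  qed
  have h_cont: "continuous_map euclidean (product_topology X UNIV) h"
    unfolding h_eq by (rule continuous_map_compose[OF T_cont H_cont])
  have v_inj: "inj (v m)" for m
  proof (rule injI)
    fix z w assume "v m z = v m w"
    then have "T (\<lambda>_. z) m = T (\<lambda>_. w) m"
      unfolding v_def by (rule injD[OF u(2)])
    then show "z = w" by (rule cubing_inj[OF T(1)])
  qed
  have v_cont: "continuous_map euclidean (X m) (v m)" for m
  proof -
    have "continuous_map euclidean (product_topology (\<lambda>_::nat. euclidean) UNIV)
        (\<lambda>(z :: nat \<Rightarrow> bool) _. z)"
      unfolding continuous_map_componentwise_UNIV by simp
    then have "continuous_map euclidean euclidean (\<lambda>(z :: nat \<Rightarrow> bool) _::nat. z)"
      by (simp only: euclidean_product_topology)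
    from continuous_map_compose[OF this h_cont]
    show ?thesis
      unfolding continuous_map_componentwise_UNIV by (simp add: h_def comp_def)
  qed
  define P where "P = (\<Pi>\<^sub>E m\<in>UNIV. range (v m))"
  have "perfect_cube X P"
    unfolding perfect_cube_def P_def using perfect_in_range[OF haus v_cont v_inj]
    by (intro exI[of _ "\<lambda>m. range (v m)"]) simp
  moreover have range_h: "range h = P"
  proof
    show "P \<subseteq> range h"
    proof
      fix y assume "y \<in> P"
      then have "\<forall>m. \<exists>z. y m = v m z" by (auto simp: P_def PiE_UNIV_domain)
      then obtain x where "\<And>m. y m = v m (x m)" by metis
      then have "y = h x" by (simp add: h_def fun_eq_iff)
      then show "y \<in> range h" by blast
    qed
  qed (auto simp: P_def h_def)
  have "inj h"
    using injD[OF v_inj] by (intro injI ext) (metis h_def)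
  moreover have "Hausdorff_space (product_topology X UNIV)"
    unfolding Hausdorff_space_product_topology using haus by blast
  ultimately have "embedding_map euclidean (product_topology X UNIV) h"
    using continuous_imp_embedding_map[OF h_cont compact_space_points] by simp
  then obtain k where k: "homeomorphic_maps euclidean (subtopology (product_topology X UNIV) P) h k"
    unfolding embedding_map_def homeomorphic_map_maps using range_h by auto
  have "continuous_map (subtopology (product_topology X UNIV) P) (mtopology_of M) (f n)" for n
  proof (rule continuous_map_eq)
    show "continuous_map (subtopology (product_topology X UNIV) P) (mtopology_of M) ((f n \<circ> H \<circ> T) \<circ> k)"
      using k T(2) unfolding homeomorphic_maps_def mtopology_of_def
      by (blast intro: continuous_map_compose)
    fix y assume "y \<in> topspace (subtopology (product_topology X UNIV) P)"
    then have "h (k y) = y"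
      using k unfolding homeomorphic_maps_def by blast
    then show "(f n \<circ> H \<circ> T \<circ> k) y = f n y" by (simp add: h_eq)
  qed
  with \<open>perfect_cube X P\<close> show ?thesis by blast
qed

end
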